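(* Let $0\le m\le n$ be integers. If $c(x)$ is a polynomial of degree $n-m$, then $$U_n c(x)=(1-x)^m\frac{(n-m)!}{n!}U_{n-m}c(x).$$ Correspondingly, if $d(x)$ is a polynomial of degree at most $n-m$, then $$U_n^{-1}\big((1-x)^m d(x)\big)=\frac{n!}{(n-m)!}U_{n-m}^{-1}d(x).$$
   Context: Polynomials over $\mathbb{C}$. For each $k\ge0$, $U_k$ is the linear map on polynomials of degree at most $k$ defined by $U_kx^p=\frac{(1-x)^{k+1}}{k!}\sum_{j\ge0}j^px^j$ ($0\le p\le k$, $0^0=1$); it is invertible with $U_k^{-1}x^p=(x)_p[x+1]_{k-p}$, where $(y)_p=y(y-1)\cdots(y-p+1)$ and $[y]_q=y(y+1)\cdots(y+q-1)$. *)

theory Defs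
  imports
    Complex_Main
    "HOL-Computational_Algebra.Polynomial"
    "HOL-Computational_Algebra.Polynomial_FPS"
begin

text \<open>The infinite sum over \<open>j\<close> is read as a formal power series in \<open>x\<close>.\<close>

definition U_series :: "nat \<Rightarrow> nat \<Rightarrow> complex fps" where
  "U_series k p = fps_const (1 / fact k) * (1 - fps_X) ^ (k + 1) * Abs_fps (\<lambda>j. of_nat j ^ p)"

text \<open>For \<open>p \<le> k\<close> that series is a polynomial of degree at most \<open>k\<close>;
  see \<open>fps_of_poly_U_monom\<close> and \<open>degree_U_monom\<close> below.\<close>

definition U_monom :: "nat \<Rightarrow> nat \<Rightarrow> complex poly" where
  "U_monom k p = (THE q. fps_of_poly q = U_series k p)"

definition U_dom :: "nat \<Rightarrow> complex poly set" where
  "U_dom k = {f. degree f \<le> k}"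

text \<open>Linear extension from the monomials. \<open>U k f\<close> is meaningful only for \<open>f \<in> U_dom k\<close>.\<close>

definition U :: "nat \<Rightarrow> complex poly \<Rightarrow> complex poly" where
  "U k f = (\<Sum>p\<le>k. smult (coeff f p) (U_monom k p))"

text \<open>Meaningful because \<open>U k\<close> is a bijection of \<open>U_dom k\<close> onto itself;
  see \<open>bij_betw_U\<close> below, and \<open>U_inv_monom\<close> for the explicit values.\<close>

definition U_inv :: "nat \<Rightarrow> complex poly \<Rightarrow> complex poly" where
  "U_inv k = the_inv_into (U_dom k) (U k)"


subsection \<open>Well-definedness\<close>

lemma power_series_eulerian:
  "\<exists>q. degree q \<le> p \<and>
       fps_of_poly q = (1 - fps_X) ^ (p + 1) * Abs_fps (\<lambda>j. of_nat j ^ p :: complex)"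
proof (induction p)
  case 0
  have "(1 - fps_X) * Abs_fps (\<lambda>j. 1 :: complex) = 1"
    by (simp add: fps_eq_iff algebra_simps)
  then show ?case by (intro exI[of _ 1]) simp
next
  case (Suc p)
  let ?T = "\<lambda>p. Abs_fps (\<lambda>j. of_nat j ^ p :: complex)"
  from Suc obtain q where q: "degree q \<le> p" "fps_of_poly q = (1 - fps_X) ^ (p + 1) * ?T p"
    by blast
  define r where "r = pCons 0 ([:1, -1:] * pderiv q + smult (of_nat (p + 1)) q)"
  have T: "?T (Suc p) = fps_X * fps_deriv (?T p)"
    by (auto simp: fps_eq_iff)
  have lin: "fps_of_poly [:1, -1:] = (1 - fps_X :: complex fps)"
    by (simp add: fps_of_poly_linear')
  have "fps_deriv ((1 - fps_X) ^ (p + 1) :: complex fps) = - (of_nat (p + 1) * (1 - fps_X) ^ p)"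
    by (simp only: fps_deriv_power' add_diff_cancel_right') (simp add: algebra_simps)
  then have D: "fps_deriv ((1 - fps_X) ^ (p + 1) * ?T p :: complex fps) =
          (1 - fps_X) ^ (p + 1) * fps_deriv (?T p) - of_nat (p + 1) * (1 - fps_X) ^ p * ?T p"
    unfolding fps_deriv_mult by (simp only: minus_mult_left[symmetric] diff_conv_add_uminus)
  have "A * (A ^ (p + 1) * E - c * A ^ p * T) + c * (A ^ (p + 1) * T) = A ^ (p + 2) * E"
    for A E c T :: "complex fps"
    by (simp add: algebra_simps)
  then have "(1 - fps_X) * fps_deriv (fps_of_poly q) + of_nat (p + 1) * fps_of_poly q =
          (1 - fps_X) ^ (p + 2) * fps_deriv (?T p)"
    unfolding q(2) D .
  then have "fps_of_poly r = (1 - fps_X) ^ (p + 2) * fps_deriv (?T p) * fps_X"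
    unfolding r_def fps_of_poly_pCons[of 0] fps_of_poly_add fps_of_poly_mult fps_of_poly_smult lin
      fps_of_poly_pderiv
    by (simp only: fps_of_nat fps_const_0_eq_0 add_0)
  then have "fps_of_poly r = (1 - fps_X) ^ (Suc p + 1) * ?T (Suc p)"
    unfolding T by (simp add: mult_ac)
  moreover have "degree r \<le> Suc p"
  proof -
    have "degree ([:1, -1:] * pderiv q) \<le> p"
    proof (cases "pderiv q = 0")
      case False
      then have "degree q > 0" by (simp add: pderiv_eq_0_iff)
      then show ?thesis
        using degree_mult_le[of "[:1, -1:]" "pderiv q"] q(1) by (simp add: degree_pderiv)
    qed simp
    moreover have "degree (smult (of_nat (p + 1)) q) \<le> p"
      using q(1) degree_smult_le order_trans by blast
    ultimately have "degree ([:1, -1:] * pderiv q + smult (of_nat (p + 1)) q) \<le> p"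
      by (rule degree_add_le)
    then show ?thesis unfolding r_def by (simp add: degree_pCons_eq_if)
  qed
  ultimately show ?case by blast
qed

lemma U_monom_aux:
  assumes "p \<le> k"
  shows "fps_of_poly (U_monom k p) = U_series k p \<and> degree (U_monom k p) \<le> k"
proof -
  obtain q where q: "degree q \<le> p"
      "fps_of_poly q = (1 - fps_X) ^ (p + 1) * Abs_fps (\<lambda>j. of_nat j ^ p :: complex)"
    using power_series_eulerian by blast
  define r where "r = smult (1 / fact k) ([:1, -1:] ^ (k - p) * q)"
  have lin: "fps_of_poly [:1, -1:] = (1 - fps_X :: complex fps)"
    by (simp add: fps_of_poly_linear')
  have "(1 - fps_X :: complex fps) ^ (k + 1) = (1 - fps_X) ^ (k - p) * (1 - fps_X) ^ (p + 1)"
    using assms by (simp flip: power_add)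
  then have r: "fps_of_poly r = U_series k p"
    by (simp add: r_def U_series_def fps_of_poly_smult fps_of_poly_mult fps_of_poly_power lin q(2)
        mult.assoc)
  have "degree r \<le> degree ([:1, -1:] ^ (k - p) :: complex poly) + degree q"
    unfolding r_def using degree_smult_le degree_mult_le order_trans by blast
  also have "\<dots> \<le> (k - p) + p"
    using q(1) degree_power_le[of "[:1, -1 :: complex:]" "k - p"] by (intro add_mono) auto
  finally have "degree r \<le> k" using assms by simp
  moreover have "U_monom k p = r"
    unfolding U_monom_def
    by (rule the_equality) (use r in \<open>auto simp flip: fps_of_poly_eq_iff\<close>)
  ultimately show ?thesis using r by simp
qed

lemma fps_of_poly_U_monom: "p \<le> k \<Longrightarrow> fps_of_poly (U_monom k p) = U_series k p"
  using U_monom_aux by blast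

lemma degree_U_monom: "p \<le> k \<Longrightarrow> degree (U_monom k p) \<le> k"
  using U_monom_aux by blast

lemma U_monom_eq: "p \<le> k \<Longrightarrow> U k (monom 1 p) = U_monom k p"
  unfolding U_def by (simp add: if_distrib[of "\<lambda>c. smult c _"] cong: if_cong)

lemma U_add: "U k (f + g) = U k f + U k g"
  by (simp add: U_def smult_add_left sum.distrib)

lemma U_smult: "U k (smult c f) = smult c (U k f)"
  using sum_distrib_left[of "[:c:]" "\<lambda>p. smult (coeff f p) (U_monom k p)" "{..k}"]
  by (simp add: U_def mult.commute)

lemma U_diff: "U k (f - g) = U k f - U k g"
  by (simp add: U_def smult_diff_left sum_subtractf)

lemma U_0: "U k 0 = 0"
  by (simp add: U_def)

lemma U_sum: "U k (sum f A) = (\<Sum>a\<in>A. U k (f a))"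
  by (induction A rule: infinite_finite_induct) (simp_all add: U_add U_0)

lemma degree_U: "degree (U k f) \<le> k"
  unfolding U_def by (intro degree_sum_le order_trans[OF degree_smult_le degree_U_monom]) auto

lemma fps_of_poly_U:
  assumes "degree f \<le> k"
  shows "fps_of_poly (U k f) =
           fps_const (1 / fact k) * (1 - fps_X) ^ (k + 1) * Abs_fps (\<lambda>j. poly f (of_nat j))"
proof -
  have "fps_of_poly (U k f) = (\<Sum>p\<le>k. fps_const (coeff f p) * U_series k p)"
    unfolding U_def fps_of_poly_sum fps_of_poly_smult by (simp add: fps_of_poly_U_monom)
  also have "\<dots> = fps_const (1 / fact k) * (1 - fps_X) ^ (k + 1) *
                    (\<Sum>p\<le>k. fps_const (coeff f p) * Abs_fps (\<lambda>j. of_nat j ^ p))"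
    unfolding U_series_def sum_distrib_left by (intro sum.cong) (simp_all add: mult_ac)
  also have "(\<Sum>p\<le>k. fps_const (coeff f p) * Abs_fps (\<lambda>j. of_nat j ^ p)) =
               Abs_fps (\<lambda>j. poly f (of_nat j))"
  proof (rule fps_ext)
    fix j
    have "poly f x = (\<Sum>p\<le>k. coeff f p * x ^ p)" for x
      by (subst poly_as_sum_of_monoms'[OF assms, symmetric]) (simp add: poly_sum poly_monom)
    then show "fps_nth (\<Sum>p\<le>k. fps_const (coeff f p) * Abs_fps (\<lambda>j. of_nat j ^ p)) j =
                 fps_nth (Abs_fps (\<lambda>j. poly f (of_nat j))) j"
      by (simp add: fps_sum_nth)
  qed
  finally show ?thesis .
qed


subsection \<open>Invertibility\<close>

lemma inj_on_U: "inj_on (U k) (U_dom k)"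
proof (rule inj_onI)
  fix f g assume fg: "f \<in> U_dom k" "g \<in> U_dom k" "U k f = U k g"
  define h where "h = f - g"
  have h: "degree h \<le> k" "U k h = 0"
    using fg by (auto simp: h_def U_dom_def U_diff intro: degree_diff_le)
  have "(1 - fps_X :: complex fps) \<noteq> 0"
    by (auto simp: fps_eq_iff intro!: exI[of _ 0])
  then have "Abs_fps (\<lambda>j. poly h (of_nat j)) = 0"
    using fps_of_poly_U[OF h(1)] h(2) by simp
  then have "poly h (of_nat j) = 0" for j
    by (simp add: fps_eq_iff)
  then have "range of_nat \<subseteq> {x. poly h x = 0}" by auto
  moreover have "infinite (range (of_nat :: nat \<Rightarrow> complex))"
    by (simp add: finite_image_iff inj_of_nat)
  ultimately have "infinite {x. poly h x = 0}" by (rule infinite_super)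
  then have "h = 0" using poly_roots_finite[of h] by blast
  then show "f = g" by (simp add: h_def)
qed

lemma one_minus_fps_X_power_mult:
  "(1 - fps_X) ^ (k + 1) * Abs_fps (\<lambda>n. of_nat ((k + n) choose k) :: complex) = 1"
proof (induction k)
  case 0
  show ?case by (simp add: fps_eq_iff algebra_simps)
next
  case (Suc k)
  have "(1 - fps_X) * Abs_fps (\<lambda>n. of_nat ((Suc k + n) choose Suc k) :: complex) =
          Abs_fps (\<lambda>n. of_nat ((k + n) choose k))"
  proof (rule fps_ext)
    fix n
    show "fps_nth ((1 - fps_X) * Abs_fps (\<lambda>n. of_nat ((Suc k + n) choose Suc k) :: complex)) n =
          fps_nth (Abs_fps (\<lambda>n. of_nat ((k + n) choose k))) n"
      by (cases n) (simp_all add: left_diff_distrib)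
  qed
  moreover have "(1 - fps_X) ^ (Suc k + 1) * F = (1 - fps_X) ^ (k + 1) * ((1 - fps_X) * F)"
    for F :: "complex fps"
    by (simp add: mult_ac)
  ultimately show ?case using Suc by (simp only:)
qed

lemma U_falling_rising:
  assumes "p \<le> k"
  defines "g \<equiv> (\<Prod>i<p. [:- of_nat i, 1:]) * (\<Prod>i<k - p. [:1 + of_nat i, 1 :: complex:])"
  shows "g \<in> U_dom k" "U k g = monom 1 p"
proof -
  have "degree g \<le> p + (k - p)"
    unfolding g_def
    by (intro order_trans[OF degree_mult_le] add_mono order_trans[OF degree_prod_sum_le]) auto
  then have deg: "degree g \<le> k" using assms by simp
  then show "g \<in> U_dom k" by (simp add: U_dom_def)
  have val: "poly g (of_nat j) =
      (if j < p then 0 else fact k * of_nat ((k + (j - p)) choose k))" for j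
  proof (cases "j < p")
    case True
    then have "(\<Prod>i<p. of_nat j - of_nat i :: complex) = 0" by (intro prod_zero) auto
    with True show ?thesis by (simp add: g_def poly_prod)
  next
    case False
    have "(\<Prod>i<p. of_nat j - of_nat i :: complex) * fact (j - p) = fact j" if "p \<le> j" for p
      using that
    proof (induction p)
      case (Suc p)
      then have "(fact (j - p) :: complex) = of_nat (j - p) * fact (j - Suc p)"
        by (metis Suc_diff_Suc Suc_le_eq fact_Suc of_nat_mult)
      with Suc show ?case by (simp add: of_nat_diff mult_ac)
    qed simp
    with False have A: "(\<Prod>i<p. of_nat j - of_nat i :: complex) * fact (j - p) = fact j" by simp
    have B: "fact j * (\<Prod>i<q. 1 + of_nat i + of_nat j :: complex) = fact (j + q)" for q
    proof (induction q)
      case (Suc q)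
      have "fact j * (\<Prod>i<Suc q. 1 + of_nat i + of_nat j :: complex) =
              fact (j + q) * (1 + of_nat q + of_nat j)"
        unfolding Suc[symmetric] by simp
      then show ?case by (simp add: algebra_simps)
    qed simp
    have "poly g (of_nat j) * fact (j - p) = fact (j + (k - p))"
      unfolding B[of "k - p", symmetric] A[symmetric] by (simp add: g_def poly_prod mult_ac add_ac)
    moreover have "fact k * fact (j - p) * of_nat ((k + (j - p)) choose k) =
                     (fact (k + (j - p)) :: complex)"
      using arg_cong[OF binomial_fact_lemma[of k "k + (j - p)"], of "of_nat :: nat \<Rightarrow> complex"]
      by simp
    moreover have "k + (j - p) = j + (k - p)" using assms(1) False by simp
    ultimately have "poly g (of_nat j) * fact (j - p) =
        (fact k * of_nat ((k + (j - p)) choose k)) * fact (j - p)"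
      by (simp add: mult_ac)
    with False show ?thesis by simp
  qed
  have "Abs_fps (\<lambda>j. poly g (of_nat j)) =
      fps_const (fact k) * (fps_X ^ p * Abs_fps (\<lambda>n. of_nat ((k + n) choose k) :: complex))"
    by (simp add: fps_eq_iff val fps_X_power_mult_nth)
  then have "fps_of_poly (U k g) = (fps_const (1 / fact k) * fps_const (fact k)) * fps_X ^ p *
      ((1 - fps_X) ^ (k + 1) * Abs_fps (\<lambda>n. of_nat ((k + n) choose k) :: complex))"
    unfolding fps_of_poly_U[OF deg] by (simp only: mult_ac)
  also have "\<dots> = fps_of_poly (monom 1 p)"
    unfolding one_minus_fps_X_power_mult by (simp add: fps_of_poly_monom')
  finally show "U k g = monom 1 p" by (simp only: fps_of_poly_eq_iff)
qed

lemma bij_betw_U: "bij_betw (U k) (U_dom k) (U_dom k)"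
proof -
  have "f \<in> U k ` U_dom k" if "f \<in> U_dom k" for f
  proof -
    define G where
      "G p = (\<Prod>i<p. [:- of_nat i, 1:]) * (\<Prod>i<k - p. [:1 + of_nat i, 1 :: complex:])" for p
    have G: "G p \<in> U_dom k" "U k (G p) = monom 1 p" if "p \<le> k" for p
      unfolding G_def using U_falling_rising[OF that] by blast+
    define h where "h = (\<Sum>p\<le>k. smult (coeff f p) (G p))"
    have "h \<in> U_dom k"
      unfolding h_def U_dom_def mem_Collect_eq
      by (intro degree_sum_le)
         (use G in \<open>auto simp: U_dom_def intro: order_trans[OF degree_smult_le]\<close>)
    moreover have "U k h = f"
      using that G by (simp add: h_def U_sum U_smult U_dom_def smult_monom poly_as_sum_of_monoms')
    ultimately show ?thesis by blast
  qed
  then show ?thesis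
    unfolding bij_betw_def using inj_on_U degree_U by (auto simp: U_dom_def)
qed

lemma U_inv_monom:
  assumes "p \<le> k"
  shows "U_inv k (monom 1 p) =
           (\<Prod>i<p. [:- of_nat i, 1:]) * (\<Prod>i<k - p. [:1 + of_nat i, 1 :: complex:])"
  unfolding U_inv_def
  by (rule the_inv_into_f_eq) (use inj_on_U U_falling_rising[OF assms] in auto)

end

theory Submission
  imports Defs
begin

text \<open>By \<open>fps_of_poly_U\<close>, \<open>U k f\<close> is (1-x)^(k+1)/k! times the
  generating series of the values f(0), f(1), ..., and this series does not depend on k. Passing
  from k = n-m to k = n therefore only multiplies the prefactor by (1-x)^m (n-m)!/n!, which is
  \<open>U_degree_le\<close>. The inverse formula is the same identity read at the preimage of d,
  since \<open>U n\<close> is injective on \<open>U_dom n\<close>.\<close>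

text \<open>The bound on the degree, in place of equality, lets the identity apply to
  \<open>U_inv (n - m) d\<close>, whose exact degree is not known.\<close>

lemma U_degree_le:
  assumes "m \<le> n" "degree c \<le> n - m"
  shows "U n c = [:1, -1:] ^ m * smult (fact (n - m) / fact n) (U (n - m) c)"
proof -
  have lin: "fps_of_poly [:1, -1:] = (1 - fps_X :: complex fps)"
    by (simp add: fps_of_poly_linear')
  \<comment> \<open>\<open>const\<close> and \<open>pow\<close> split the prefactor for n into the
    one for n-m and the extra factor, so that both sides agree up to reordering.\<close>
  have const: "fps_const (1 / fact n :: complex) =
      fps_const (fact (n - m) / fact n) * fps_const (1 / fact (n - m))"
    by simp
  have pow: "(1 - fps_X :: complex fps) ^ (n + 1) = (1 - fps_X) ^ m * (1 - fps_X) ^ (n - m + 1)"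
    using assms(1) by (simp flip: power_add)
  have "degree c \<le> n" using assms by simp
  then have "fps_of_poly (U n c) =
      fps_of_poly ([:1, -1:] ^ m * smult (fact (n - m) / fact n) (U (n - m) c))"
    unfolding fps_of_poly_mult fps_of_poly_power fps_of_poly_smult lin
      fps_of_poly_U[OF assms(2)] fps_of_poly_U[OF \<open>degree c \<le> n\<close>] const pow
    by (simp only: mult_ac)
  then show ?thesis by (simp only: fps_of_poly_eq_iff)
qed

lemma U_inv_in_U_dom: "d \<in> U_dom k \<Longrightarrow> U_inv k d \<in> U_dom k"
  unfolding U_inv_def using bij_betw_the_inv_into[OF bij_betw_U] by (rule bij_betwE[rule_format])

lemma U_U_inv: "d \<in> U_dom k \<Longrightarrow> U k (U_inv k d) = d"
  unfolding U_inv_def using bij_betw_U by (rule f_the_inv_into_f_bij_betw)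

lemma U_inv_eqI: "f \<in> U_dom k \<Longrightarrow> U k f = d \<Longrightarrow> U_inv k d = f"
  unfolding U_inv_def by (rule the_inv_into_f_eq[OF inj_on_U])

theorem theorem2p4:
  fixes m n :: nat
  assumes "m \<le> n"
  shows "(\<forall>c :: complex poly. degree c = n - m \<longrightarrow>
            U n c = [:1, -1:] ^ m * smult (fact (n - m) / fact n) (U (n - m) c)) \<and>
         (\<forall>d :: complex poly. degree d \<le> n - m \<longrightarrow>
            U_inv n ([:1, -1:] ^ m * d) = smult (fact n / fact (n - m)) (U_inv (n - m) d))"
proof (intro conjI allI impI)
  fix c :: "complex poly"
  assume "degree c = n - m"
  then show "U n c = [:1, -1:] ^ m * smult (fact (n - m) / fact n) (U (n - m) c)"
    using U_degree_le[OF assms] by simp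
next
  fix d :: "complex poly"
  assume "degree d \<le> n - m"
  then have d: "d \<in> U_dom (n - m)" by (simp add: U_dom_def)
  define e where "e = U_inv (n - m) d"
  have deg: "degree e \<le> n - m"
    using U_inv_in_U_dom[OF d] by (simp add: U_dom_def e_def)
  show "U_inv n ([:1, -1:] ^ m * d) = smult (fact n / fact (n - m)) (U_inv (n - m) d)"
    unfolding e_def[symmetric]
  \<comment> \<open>Preimages in \<open>U_dom n\<close> are unique, so it suffices to check the
    candidate.\<close>
  proof (rule U_inv_eqI)
    show "smult (fact n / fact (n - m)) e \<in> U_dom n"
      using deg by (simp add: U_dom_def)
    \<comment> \<open>By linearity the scalar n!/(n-m)! cancels the (n-m)!/n! from
      \<open>U_degree_le\<close>.\<close>
    show "U n (smult (fact n / fact (n - m)) e) = [:1, -1:] ^ m * d"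
      using U_degree_le[OF assms deg] U_U_inv[OF d] by (simp add: U_smult e_def)
  qed
qed

end
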